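(* Let $n\ge 1$ be an integer and let \[ \rho(n):=\max\{r:T_r\le n\}=\left\lfloor\frac{\sqrt{8n+1}-1}{2}\right\rfloor,\qquad T_r=\frac{r(r+1)}{2}. \] If $\lambda\in\operatorname{MaxDeg}(n)$, i.e. if $\lambda$ is a partition of $n$ whose degree in the partition graph $G_n$ is maximal, then \[ |\operatorname{supp}(\lambda)|=\rho(n). \]
   Context: A partition $\lambda\vdash n$ is a finite nonincreasing sequence of positive integers with sum $n$; $\operatorname{supp}(\lambda)$ is the set of distinct part sizes of $\lambda$. The partition graph $G_n$ ($n\ge 1$) is the simple graph whose vertices are the partitions of $n$; two distinct partitions are adjacent if one is obtained from the other by an elementary transfer of one unit between two parts, followed by reordering: one part is decreased by $1$ and another part is increased by $1$. Here the receiving part may be an empty part of size $0$ (so that a new part $1$ is created), and a part that becomes $0$ is discarded. $\deg(\lambda)$ denotes the degree of the vertex $\lambda$ in $G_n$, $\Delta_n:=\max_{\lambda\vdash n}\deg(\lambda)$, and $\operatorname{MaxDeg}(n):=\{\lambda\vdash n:\deg(\lambda)=\Delta_n\}$. *)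

theory Defs
  imports Complex_Main "HOL-Library.Multiset"
begin

text \<open>A finite nonincreasing sequence of positive integers is determined by its multiset of
  entries, so partitions are represented as multisets of positive parts; the reordering step of
  an elementary transfer is then implicit.\<close>

definition partitions :: "nat \<Rightarrow> nat multiset set" where
  "partitions n = {M. 0 \<notin># M \<and> sum_mset M = n}"

abbreviation supp :: "nat multiset \<Rightarrow> nat set" where
  "supp M \<equiv> set_mset M"

text \<open>The donor is an occurrence of a part \<open>a\<close>; the receiver is a different occurrence of a part
  \<open>b\<close> (possibly \<open>b = a\<close> as sizes), or an empty part \<open>b = 0\<close>, which is why one \<open>0\<close> is added to
  the remaining parts. The filter discards a part that has become \<open>0\<close>.\<close>

definition transfer :: "nat multiset \<Rightarrow> nat multiset \<Rightarrow> bool" where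
  "transfer M N \<longleftrightarrow>
     (\<exists>a b. a \<in># M \<and> b \<in># add_mset 0 (M - {#a#}) \<and>
        N = filter_mset (\<lambda>x. x > 0)
              (add_mset (a - 1) (add_mset (b + 1) (add_mset 0 (M - {#a#}) - {#b#}))))"

definition adjacent :: "nat multiset \<Rightarrow> nat multiset \<Rightarrow> bool" where
  "adjacent M N \<longleftrightarrow> M \<noteq> N \<and> (transfer M N \<or> transfer N M)"

definition deg :: "nat \<Rightarrow> nat multiset \<Rightarrow> nat" where
  "deg n M = card {N \<in> partitions n. adjacent M N}"

definition max_degree :: "nat \<Rightarrow> nat" where
  "max_degree n = Max (deg n ` partitions n)"

definition MaxDeg :: "nat \<Rightarrow> nat multiset set" where
  "MaxDeg n = {M \<in> partitions n. deg n M = max_degree n}"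

definition triangular :: "nat \<Rightarrow> nat" where
  "triangular r = r * (r + 1) div 2"

definition rho :: "nat \<Rightarrow> nat" where
  "rho n = Max {r. triangular r \<le> n}"

text \<open>\<^const>\<open>card\<close> and \<^const>\<open>Max\<close> above are only applied to finite sets, and the latter only to
  nonempty ones.\<close>

lemma finite_partitions: "finite (partitions n)"
proof -
  have "partitions n \<subseteq> mset ` {xs. set xs \<subseteq> {..n} \<and> length xs \<le> n}"
  proof
    fix M assume M: "M \<in> partitions n"
    obtain xs where xs: "mset xs = M" using ex_mset by blast
    have pos: "0 \<notin> set xs" and sum: "sum_list xs = n"
      using M xs by (auto simp: partitions_def sum_mset_sum_list)
    have "set xs \<subseteq> {..n}"
      using sum member_le_sum_list by fastforce
    moreover have "0 \<notin> set ys \<Longrightarrow> length ys \<le> sum_list ys" for ys :: "nat list"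
      by (induction ys) auto
    with pos sum have "length xs \<le> n" by blast
    ultimately show "M \<in> mset ` {xs. set xs \<subseteq> {..n} \<and> length xs \<le> n}"
      using xs by blast
  qed
  then show ?thesis
    by (rule finite_subset) (intro finite_imageI finite_lists_length_le finite_atMost)
qed

lemma partitions_nonempty: "partitions n \<noteq> {}"
proof -
  have "replicate_mset n 1 \<in> partitions n"
    by (auto simp: partitions_def)
  then show ?thesis by blast
qed

lemma finite_triangular_le: "finite {r. triangular r \<le> n}"
proof (rule finite_subset)
  have "r \<le> triangular r" for r
    unfolding triangular_def by (induction r) auto
  then show "{r. triangular r \<le> n} \<subseteq> {..n}"
    using order_trans by blast
qed simp

lemma triangular_le_nonempty: "{r. triangular r \<le> n} \<noteq> {}"
proof -
  have "0 \<in> {r. triangular r \<le> n}"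
    by (simp add: triangular_def)
  then show ?thesis by blast
qed

end

theory Submission
  imports Defs
begin

text \<open>A transfer from a part \<open>a\<close> to a part \<open>b\<close> (possibly \<open>b = 0\<close>) changes the conjugate partition,
  i.e. the numbers of parts of size at least \<open>t\<close> for \<open>t \<ge> 1\<close>, only by moving one unit from position
  \<open>a\<close> to position \<open>b + 1\<close>. Hence the pair \<open>(a, b)\<close> can be read off from the result, unless
  \<open>a = b + 1\<close>, in which case nothing changes. If \<open>S\<close> is the support of \<open>M\<close> and \<open>r = |S|\<close>, then of the
  \<open>r (r + 1)\<close> pairs in \<open>S \<times> (S \<union> {0})\<close> exactly the following do not give a neighbour: the pairs
  \<open>(a, a - 1)\<close>, and the pairs \<open>(a, a)\<close> with \<open>a\<close> of multiplicity one. This is the degree formula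
  \<open>deg_formula\<close>; in particular the degree lies between \<open>r (r - 1)\<close> and \<open>r (r + 1)\<close>.

  Let \<open>r = rho n\<close>, so that no partition of \<open>n\<close> has support larger than \<open>r\<close>. Adding the part
  \<open>n - T\<^sub>r \<le> r\<close> to the staircase \<open>1, \<dots>, r\<close> gives a partition of \<open>n\<close> with support of size \<open>r\<close>, hence of
  degree at least \<open>r (r - 1)\<close>, and strictly more when \<open>n > T\<^sub>r\<close>, since then some part is repeated.
  A partition with smaller support has degree at most \<open>r (r - 1)\<close>, so it can be of maximal degree
  only if \<open>n = T\<^sub>r\<close>, its support has size \<open>r - 1\<close> and nothing is lost in the degree formula: all parts
  are repeated and \<open>1\<close> is not a part. For \<open>r \<ge> 2\<close> its sum is then at least
  \<open>2 (2 + \<dots> + r) = (r - 1) (r + 2) > T\<^sub>r\<close>, and for \<open>r = 1\<close> it is empty; both are impossible.\<close>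

section \<open>Elementary transfers\<close>

text \<open>The result of the transfer with donor \<open>a\<close> and receiver \<open>b\<close>.\<close>

definition move :: "nat multiset \<Rightarrow> nat \<Rightarrow> nat \<Rightarrow> nat multiset" where
  "move M a b = filter_mset (\<lambda>x. x > 0)
     (add_mset (a - 1) (add_mset (b + 1) (add_mset 0 (M - {#a#}) - {#b#})))"

text \<open>The pairs of donor and receiver that are available in \<open>M\<close>; a part can give to another part of
  the same size only if that size is repeated.\<close>

definition movable :: "nat multiset \<Rightarrow> nat \<Rightarrow> nat \<Rightarrow> bool" where
  "movable M a b \<longleftrightarrow> a \<in># M \<and> b \<in># add_mset 0 (M - {#a#})"

text \<open>The number of parts of size at least \<open>t\<close>; for \<open>t \<ge> 1\<close> these are the entries of the conjugate
  partition.\<close>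

definition parts_ge :: "nat \<Rightarrow> nat multiset \<Rightarrow> nat" where
  "parts_ge t M = size (filter_mset (\<lambda>x. t \<le> x) M)"

lemma transfer_iff_move: "transfer M N \<longleftrightarrow> (\<exists>a b. movable M a b \<and> N = move M a b)"
  by (auto simp: transfer_def movable_def move_def)

lemma movable_iff:
  assumes "0 \<notin># M"
  shows "movable M a b \<longleftrightarrow> a \<in># M \<and> (b = 0 \<or> b \<in># M \<and> (b = a \<longrightarrow> count M a \<noteq> 1))"
proof -
  have "a \<in># M - {#a#} \<longleftrightarrow> a \<in># M \<and> count M a \<noteq> 1"
    by (auto simp: in_diff_count simp flip: count_greater_zero_iff)
  moreover have "b \<in># M - {#a#} \<longleftrightarrow> b \<in># M" if "b \<noteq> a"
    using that by (simp add: in_diff_count)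
  ultimately show ?thesis
    by (auto simp: movable_def)
qed

text \<open>Here \<open>K\<close> consists of the bystanders of the transfer. One empty part is added to \<open>M\<close>, so
  that an empty receiver needs no separate treatment.\<close>

lemma move_decompose:
  assumes "movable M a b"
  obtains K where "add_mset 0 M = add_mset a (add_mset b K)"
    and "move M a b = filter_mset (\<lambda>x. x > 0) (add_mset (a - 1) (add_mset (b + 1) K))"
proof
  let ?K = "add_mset 0 (M - {#a#}) - {#b#}"
  have "M = add_mset a (M - {#a#})" "add_mset 0 (M - {#a#}) = add_mset b ?K"
    using assms by (simp_all add: movable_def)
  then show "add_mset 0 M = add_mset a (add_mset b ?K)"
    by (metis add_mset_commute)
qed (simp add: move_def)

lemma sum_filter_positive: "sum_mset (filter_mset (\<lambda>x. x > 0) X) = sum_mset (X :: nat multiset)"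
  by (induction X) auto

lemma filter_positive_id: "0 \<notin># M \<Longrightarrow> filter_mset (\<lambda>x. x > 0) M = (M :: nat multiset)"
  by (induction M) auto

lemma move_in_partitions:
  assumes "M \<in> partitions n" "movable M a b"
  shows "move M a b \<in> partitions n"
proof -
  obtain K where K: "add_mset 0 M = add_mset a (add_mset b K)"
    and N: "move M a b = filter_mset (\<lambda>x. x > 0) (add_mset (a - 1) (add_mset (b + 1) K))"
    using move_decompose[OF assms(2)] .
  have "a > 0"
    using assms by (metis movable_def partitions_def mem_Collect_eq gr0I)
  moreover have "sum_mset M = a + (b + sum_mset K)"
    using arg_cong[OF K, of sum_mset] by simp
  moreover have "sum_mset (move M a b) = (a - 1) + (b + 1 + sum_mset K)"
    unfolding N sum_filter_positive by simp
  ultimately show ?thesis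
    using assms(1) by (simp add: partitions_def N)
qed

text \<open>The reverse of a transfer from \<open>a\<close> to \<open>b\<close> is the transfer from \<open>b + 1\<close> to \<open>a - 1\<close>, where
  \<open>a - 1\<close> may be an empty part. So the neighbours of \<open>M\<close> are the results of the moves out of \<open>M\<close>
  that change \<open>M\<close>.\<close>

lemma transfer_sym:
  assumes "0 \<notin># M" "transfer M N"
  shows "transfer N M"
proof -
  obtain a b where ab: "movable M a b" "N = move M a b"
    using assms(2) by (auto simp: transfer_iff_move)
  obtain K where K: "add_mset 0 M = add_mset a (add_mset b K)"
    and N: "N = filter_mset (\<lambda>x. x > 0) (add_mset (a - 1) (add_mset (b + 1) K))"
    using move_decompose[OF ab(1)] ab(2) by blast
  have "a > 0"
    using assms(1) ab(1) by (metis movable_def gr0I)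
  let ?F = "filter_mset (\<lambda>x. x > 0)"
  have diff: "N - {#b + 1#} = ?F (add_mset (a - 1) K)"
    by (simp add: N)
  have movable: "movable N (b + 1) (a - 1)"
    unfolding movable_def diff by (auto simp: N)
  have "?F (add_mset 0 (N - {#b + 1#}) - {#a - 1#}) = ?F K"
    unfolding diff by (auto simp: filter_filter_mset)
  moreover have "b + 1 - 1 = b" "a - 1 + 1 = a"
    using \<open>a > 0\<close> by simp_all
  ultimately have "move N (b + 1) (a - 1) = ?F (add_mset b (add_mset a K))"
    by (simp only: move_def filter_mset_add_mset)
  also have "\<dots> = ?F (add_mset 0 M)"
    by (simp add: K add_mset_commute)
  also have "\<dots> = M"
    using assms(1) by (simp add: filter_positive_id)
  finally show ?thesis
    using movable unfolding transfer_iff_move by metis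
qed

section \<open>The degree formula\<close>

lemma parts_ge_move:
  assumes "movable M a b" "a > 0" "t > 0"
  shows "parts_ge t (move M a b) + of_bool (t = a) = parts_ge t M + of_bool (t = b + 1)"
proof -
  obtain K where K: "add_mset 0 M = add_mset a (add_mset b K)"
    and N: "move M a b = filter_mset (\<lambda>x. x > 0) (add_mset (a - 1) (add_mset (b + 1) K))"
    using move_decompose[OF assms(1)] .
  have add: "parts_ge t (add_mset x X) = of_bool (t \<le> x) + parts_ge t X" for x X
    by (simp add: parts_ge_def)
  have "parts_ge t M = of_bool (t \<le> a) + (of_bool (t \<le> b) + parts_ge t K)"
    using arg_cong[OF K, of "parts_ge t"] assms(3) unfolding add by simp
  moreover have "parts_ge t (filter_mset (\<lambda>x. x > 0) X) = parts_ge t X" for X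
    using assms(3) by (induction X) (auto simp: parts_ge_def)
  then have "parts_ge t (move M a b) = of_bool (t \<le> a - 1) + (of_bool (t \<le> b + 1) + parts_ge t K)"
    unfolding N by (simp only: add)
  ultimately show ?thesis
    using assms(2) by (auto simp: of_bool_def)
qed

lemma move_eq_self_iff:
  assumes "0 \<notin># M" "movable M a b"
  shows "move M a b = M \<longleftrightarrow> a = b + 1"
proof
  have "a > 0"
    using assms by (metis movable_def gr0I)
  then show "a = b + 1" if "move M a b = M"
    using parts_ge_move[OF assms(2) \<open>a > 0\<close> \<open>a > 0\<close>] unfolding that
    by (cases "a = b + 1") simp_all
  obtain K where K: "add_mset 0 M = add_mset a (add_mset b K)"
    and N: "move M a b = filter_mset (\<lambda>x. x > 0) (add_mset (a - 1) (add_mset (b + 1) K))"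
    using move_decompose[OF assms(2)] .
  show "move M a b = M" if "a = b + 1"
  proof -
    have "move M a b = filter_mset (\<lambda>x. x > 0) (add_mset 0 M)"
      unfolding K N using that by (simp add: add_mset_commute)
    then show ?thesis
      using assms(1) by (simp add: filter_positive_id)
  qed
qed

lemma move_inject:
  assumes "0 \<notin># M" "movable M a b" "movable M a' b'" "a \<noteq> b + 1" "a' \<noteq> b' + 1"
    and "move M a b = move M a' b'"
  shows "a = a' \<and> b = b'"
proof -
  have "a > 0" "a' > 0"
    using assms by (metis movable_def gr0I)+
  then have "of_bool (t = a) + of_bool (t = b' + 1) = (of_bool (t = a') + of_bool (t = b + 1) :: nat)"
    if "t > 0" for t
    using parts_ge_move[OF assms(2) \<open>a > 0\<close> that] parts_ge_move[OF assms(3) \<open>a' > 0\<close> that]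
    unfolding assms(6) by linarith
  \<comment> \<open>The multisets \<open>{a, b' + 1}\<close> and \<open>{a', b + 1}\<close> agree.\<close>
  from this[of a] this[of "b + 1"] show ?thesis
    using assms(4,5) \<open>a > 0\<close> by (auto simp: of_bool_def split: if_splits)
qed

lemma deg_eq_card_moves:
  assumes "M \<in> partitions n"
  shows "deg n M = card {(a, b). movable M a b \<and> a \<noteq> b + 1}"
proof -
  have M: "0 \<notin># M"
    using assms by (simp add: partitions_def)
  have "{N \<in> partitions n. adjacent M N} = (\<lambda>(a, b). move M a b) ` {(a, b). movable M a b \<and> a \<noteq> b + 1}"
    (is "?L = ?R")
  proof
    show "?L \<subseteq> ?R"
    proof
      fix N assume N: "N \<in> ?L"
      then have "transfer M N" "M \<noteq> N"
        using transfer_sym[of N M] by (auto simp: adjacent_def partitions_def)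
      then obtain a b where ab: "movable M a b" "N = move M a b"
        by (auto simp: transfer_iff_move)
      with \<open>M \<noteq> N\<close> have "a \<noteq> b + 1"
        using move_eq_self_iff[OF M ab(1)] by auto
      with ab show "N \<in> ?R" by force
    qed
    show "?R \<subseteq> ?L"
    proof clarify
      fix a b assume ab: "movable M a b" "a \<noteq> b + 1"
      then have "M \<noteq> move M a b" "transfer M (move M a b)"
        using move_eq_self_iff[OF M ab(1)] by (auto simp: transfer_iff_move)
      then show "move M a b \<in> partitions n \<and> adjacent M (move M a b)"
        using move_in_partitions[OF assms ab(1)] by (simp add: adjacent_def)
    qed
  qed
  moreover have "inj_on (\<lambda>(a, b). move M a b) {(a, b). movable M a b \<and> a \<noteq> b + 1}"
    using move_inject[OF M] by (auto intro!: inj_onI)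
  ultimately show ?thesis
    by (simp add: deg_def card_image)
qed

text \<open>The two corrections count the parts \<open>a\<close> for which the move from \<open>a\<close> to \<open>a - 1\<close> is available
  but has no effect, and the parts that occur only once.\<close>

theorem deg_formula:
  assumes "M \<in> partitions n"
  shows "deg n M + card {a \<in> supp M. a - 1 \<in> insert 0 (supp M)} + card {a \<in> supp M. count M a = 1}
    = card (supp M) * (card (supp M) + 1)"
proof -
  have M: "0 \<notin># M"
    using assms by (simp add: partitions_def)
  let ?S = "supp M"
  let ?A = "{(a, b). movable M a b \<and> a \<noteq> b + 1}"
  let ?B = "(\<lambda>a. (a, a - 1)) ` {a \<in> ?S. a - 1 \<in> insert 0 ?S}"
  let ?C = "(\<lambda>a. (a, a)) ` {a \<in> ?S. count M a = 1}"
  have pos: "a > 0" if "a \<in># M" for a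
    using that M by (metis gr0I)
  have split: "?S \<times> insert 0 ?S = ?A \<union> ?B \<union> ?C"
  proof (rule set_eqI, clarify)
    fix a b
    have B: "(a, b) \<in> ?B \<longleftrightarrow> a \<in># M \<and> a = b + 1 \<and> b \<in> insert 0 ?S"
      using pos by force
    have C: "(a, b) \<in> ?C \<longleftrightarrow> a \<in># M \<and> a = b \<and> count M a = 1"
      by auto
    show "(a, b) \<in> ?S \<times> insert 0 ?S \<longleftrightarrow> (a, b) \<in> ?A \<union> ?B \<union> ?C"
      unfolding Un_iff B C using M by (auto simp: movable_iff)
  qed
  have "finite (?S \<times> insert 0 ?S)"
    by simp
  then have fin: "finite ?A" "finite ?B" "finite ?C"
    unfolding split by simp_all
  have "?A \<inter> ?B = {}" "(?A \<union> ?B) \<inter> ?C = {}"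
    using pos M by (force simp: movable_iff)+
  then have "card (?S \<times> insert 0 ?S) = card ?A + card ?B + card ?C"
    unfolding split using fin by (simp add: card_Un_disjoint)
  moreover have "card ?B = card {a \<in> ?S. a - 1 \<in> insert 0 ?S}" "card ?C = card {a \<in> ?S. count M a = 1}"
    by (auto intro!: card_image inj_onI)
  ultimately show ?thesis
    using M by (simp add: deg_eq_card_moves[OF assms] card_cartesian_product)
qed

section \<open>Sums and support sizes\<close>

text \<open>The minimum is attained by \<open>{d + 1, \<dots>, d + |S|}\<close>.\<close>

lemma sum_ge_of_card:
  fixes S :: "nat set"
  assumes "finite S" "\<And>x. x \<in> S \<Longrightarrow> d < x"
  shows "card S * (card S + 1 + 2 * d) \<le> 2 * \<Sum>S"
  using assms
proof (induction S rule: finite_linorder_max_induct)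
  case (insert m S)
  have "insert m S \<subseteq> {d<..m}"
    using insert by auto
  then have "card (insert m S) \<le> m - d"
    using card_mono[of "{d<..m}"] by fastforce
  moreover have "m \<notin> S" "d < m"
    using insert by auto
  ultimately have "card S + 1 + d \<le> m"
    using insert.hyps by simp
  then show ?case
    using insert \<open>m \<notin> S\<close> by (simp add: algebra_simps)
qed simp

lemma two_triangular: "2 * triangular r = r * (r + 1)"
  by (simp add: triangular_def)

lemma sum_mset_ge_supp:
  fixes M :: "nat multiset"
  assumes "\<And>x. x \<in># M \<Longrightarrow> k \<le> count M x"
  shows "k * \<Sum>(supp M) \<le> sum_mset M"
proof -
  have "repeat_mset k (mset_set (supp M)) \<subseteq># M"
    using assms by (auto simp: subseteq_mset_def count_mset_set')
  then have "sum_mset (repeat_mset k (mset_set (supp M))) \<le> sum_mset M"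
    by (metis le_add1 subset_mset.add_diff_inverse sum_mset.union)
  moreover have "sum_mset (repeat_mset k X) = k * sum_mset X" for X :: "nat multiset"
    by (induction k) (simp_all add: repeat_mset_Suc)
  ultimately show ?thesis
    by (simp add: sum_unfold_sum_mset)
qed

lemma triangular_rho_le: "triangular (rho n) \<le> n"
  using Max_in[OF finite_triangular_le triangular_le_nonempty] by (simp add: rho_def)

lemma le_rho: "triangular r \<le> n \<Longrightarrow> r \<le> rho n"
  using Max_ge[OF finite_triangular_le] by (simp add: rho_def)

lemma less_triangular_Suc_rho: "n < triangular (Suc (rho n))"
  using le_rho[of "Suc (rho n)" n] by fastforce

lemma card_supp_le_rho:
  assumes "M \<in> partitions n"
  shows "card (supp M) \<le> rho n"
proof (rule le_rho)
  have "card (supp M) * (card (supp M) + 1) \<le> 2 * \<Sum>(supp M)"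
    using sum_ge_of_card[of "supp M" 0] assms by (simp add: partitions_def) (metis gr0I)
  moreover have "\<Sum>(supp M) \<le> n"
    using sum_mset_ge_supp[of M 1] assms by (simp add: partitions_def Suc_le_eq)
  ultimately show "triangular (card (supp M)) \<le> n"
    using two_triangular[of "card (supp M)"] by linarith
qed

lemma rho_eq_floor: "int (rho n) = \<lfloor>(sqrt (8 * real n + 1) - 1) / 2\<rfloor>"
proof (rule floor_unique[symmetric])
  let ?r = "real (rho n)"
  have "rho n * (rho n + 1) \<le> 2 * n" "2 * n + 2 \<le> Suc (rho n) * (Suc (rho n) + 1)"
    using triangular_rho_le[of n] less_triangular_Suc_rho[of n]
      two_triangular[of "rho n"] two_triangular[of "Suc (rho n)"] by linarith+
  then have "?r * (?r + 1) \<le> 2 * real n" "2 * real n + 2 \<le> (?r + 1) * (?r + 2)"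
    by (metis of_nat_le_iff of_nat_mult of_nat_add of_nat_1 of_nat_numeral,
        simp add: field_simps flip: of_nat_mult of_nat_add)
  then have "(2 * ?r + 1)\<^sup>2 \<le> 8 * real n + 1" "8 * real n + 1 < (2 * ?r + 3)\<^sup>2"
    by (simp_all add: power2_eq_square algebra_simps)
  then have "2 * ?r + 1 \<le> sqrt (8 * real n + 1)" "sqrt (8 * real n + 1) < 2 * ?r + 3"
    by (auto intro: real_le_rsqrt real_less_lsqrt)
  then show "of_int (int (rho n)) \<le> (sqrt (8 * real n + 1) - 1) / 2"
    "(sqrt (8 * real n + 1) - 1) / 2 < of_int (int (rho n)) + 1"
    by simp_all
qed

section \<open>Partitions of maximal degree\<close>

text \<open>This is \<open>max_degree n \<ge> r (r - 1)\<close> for \<open>r = rho n\<close>, with one more if \<open>n\<close> is not triangular,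
  written without subtraction.\<close>

lemma max_degree_lower_bound:
  "rho n * rho n + of_bool (triangular (rho n) < n) \<le> max_degree n + rho n"
proof -
  define r where "r = rho n"
  define k where "k = n - triangular r"
  \<comment> \<open>The staircase, with one more part of size \<open>k\<close> if \<open>k > 0\<close>; the size \<open>k\<close> is then repeated.\<close>
  define M where "M = mset_set {1..r} + (if k = 0 then {#} else {#k#})"
  have "k \<le> r"
    using less_triangular_Suc_rho[of n] by (simp add: k_def r_def triangular_def)
  have supp: "supp M = {1..r}"
    using \<open>k \<le> r\<close> by (auto simp: M_def)
  have "sum_mset M = \<Sum>{1..r} + k"
    by (simp add: M_def sum_unfold_sum_mset)
  also have "\<Sum>{1..r} = triangular r"
    by (induction r) (simp_all add: triangular_def)
  finally have M: "M \<in> partitions n"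
    using triangular_rho_le[of n] supp by (auto simp: partitions_def k_def r_def)
  have "card {a \<in> supp M. a - 1 \<in> insert 0 (supp M)} \<le> card {1..r}"
    by (intro card_mono) (auto simp: supp)
  moreover have "card {a \<in> supp M. count M a = 1} + of_bool (k > 0) \<le> r"
  proof -
    have "{a \<in> supp M. count M a = 1} \<subseteq> {1..r} - {k}"
      using \<open>k \<le> r\<close> by (auto simp: supp M_def)
    then have "card {a \<in> supp M. count M a = 1} \<le> card ({1..r} - {k})"
      by (intro card_mono) auto
    then show ?thesis
      using \<open>k \<le> r\<close> by (cases "k = 0") auto
  qed
  ultimately have "r * r + of_bool (k > 0) \<le> deg n M + r"
    using deg_formula[OF M] by (simp add: supp)
  also have "deg n M \<le> max_degree n"
    using M finite_partitions by (simp add: max_degree_def)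
  finally show ?thesis
    by (simp add: r_def k_def)
qed

theorem theorem3p5:
  fixes n :: nat and \<mu> :: "nat multiset"
  assumes "n \<ge> 1" and "\<mu> \<in> MaxDeg n"
  shows "card (supp \<mu>) = rho n \<and> int (rho n) = \<lfloor>(sqrt (8 * real n + 1) - 1) / 2\<rfloor>"
proof (intro conjI rho_eq_floor, rule ccontr)
  assume "card (supp \<mu>) \<noteq> rho n"
  define q where "q = card (supp \<mu>)"
  let ?c = "card {a \<in> supp \<mu>. a - 1 \<in> insert 0 (supp \<mu>)}"
  let ?s = "card {a \<in> supp \<mu>. count \<mu> a = 1}"
  have \<mu>: "\<mu> \<in> partitions n" "deg n \<mu> = max_degree n"
    using assms(2) by (auto simp: MaxDeg_def)
  then have "q < rho n"
    using card_supp_le_rho[of \<mu> n] \<open>card (supp \<mu>) \<noteq> rho n\<close> by (simp add: q_def)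
  then obtain p where p: "rho n = Suc p" "q \<le> p"
    by (cases "rho n") auto
  have formula: "max_degree n + ?c + ?s = q * (q + 1)"
    using deg_formula[OF \<mu>(1)] \<mu>(2) by (simp add: q_def)
  have lower: "p * (p + 1) + of_bool (triangular (rho n) < n) \<le> max_degree n"
    using max_degree_lower_bound[of n] p by simp
  have "q * (q + 1) \<le> p * (p + 1)"
    using p by (intro mult_mono) auto
  \<comment> \<open>The bounds on \<open>max_degree n\<close> from both sides coincide, so nothing is lost anywhere.\<close>
  with formula lower have "?c = 0" "?s = 0" "of_bool (triangular (rho n) < n) = (0 :: nat)"
      and "p * (p + 1) \<le> q * (q + 1)"
    by linarith+
  have "q = p"
  proof (rule ccontr)
    assume "q \<noteq> p"
    then have "q * (q + 1) < p * (p + 1)"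
      using p by (intro mult_strict_mono) auto
    with \<open>p * (p + 1) \<le> q * (q + 1)\<close> show False by simp
  qed
  have n: "n = triangular (Suc q)"
    using \<open>of_bool (triangular (rho n) < n) = (0 :: nat)\<close> triangular_rho_le[of n] p \<open>q = p\<close> by simp
  have "1 < x \<and> 2 \<le> count \<mu> x" if "x \<in># \<mu>" for x
  proof -
    have "x \<noteq> 0"
      using \<mu>(1) that by (metis partitions_def mem_Collect_eq)
    moreover have "x \<noteq> 1" "count \<mu> x \<noteq> 1"
      using \<open>?c = 0\<close> \<open>?s = 0\<close> that by auto
    moreover have "count \<mu> x \<noteq> 0"
      using that by simp
    ultimately show ?thesis by linarith
  qed
  then have "q * (q + 1 + 2 * 1) \<le> 2 * \<Sum>(supp \<mu>)" "2 * \<Sum>(supp \<mu>) \<le> n"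
    using sum_ge_of_card[of "supp \<mu>" 1] sum_mset_ge_supp[of \<mu> 2] \<mu>(1)
    by (simp_all add: q_def partitions_def)
  then have "2 * (q * (q + 3)) \<le> Suc q * (Suc q + 1)"
    using two_triangular[of "Suc q"] n by (simp add: algebra_simps)
  moreover have "q \<noteq> 0"
  proof
    assume "q = 0"
    then have "\<mu> = {#}" by (simp add: q_def)
    with \<mu>(1) assms(1) show False by (simp add: partitions_def)
  qed
  then have "q \<le> q * q" "1 \<le> q" by simp_all
  ultimately show False by (simp add: algebra_simps)
qed

end
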